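(* Let $\Omega\subset\mathbb{R}^2$ be a bounded domain with smooth boundary, $\mathbf{B}$ a $2$-form (magnetic field) on $\Omega$, and $\mathcal{C}$ a connected component of $\partial\Omega$. Let $K=\sup_s|\kappa(s)|$ be the maximum curvature of $\mathcal{C}$ and let $K'=\sup_s|\kappa'(s)|$, where $\kappa$ is the curvature of $\mathcal{C}$. Let $N>0$ be small so that normal coordinates $(n,s)$ can be defined on the collar $\Omega_{\mathcal{C}}(N)$ (see the context) and such that $N<\varepsilon/K$ for some $0<\varepsilon<1$. Suppose that on $\Omega_{\mathcal{C}}(N)$ the magnetic field $\mathbf{B}=B(n,s)\,dn\wedge ds$ has the form $$B(n,s)=\frac{M}{n^\alpha}+f(n,s),\qquad \alpha\ge 1,$$ with $M\neq 0$ a constant and $f$ a bounded smooth function, $|f|\le C_f$, with integrable $s$-partial derivative: $$\sup_s\int_0^N\left|\frac{\partial f}{\partial s}(u,s)\right|du\le D_{\mathcal{C}} .$$ Let $q(t)=(n(t),s(t))$ be a solution of the magnetic equations of motion contained in $\Omega_{\mathcal{C}}(N)$ for $0\le t\le T$ with energy $H_0$. Then (for $0\le t\le T$) $$n(t)\ \ge\ \begin{cases}\left(N^{-(\alpha-1)}+(\alpha-1)\,d(T)\right)^{-\frac{1}{\alpha-1}} & \text{if }\alpha>1,\\[4pt] N e^{-d(T)} & \text{if }\alpha=1,\end{cases}$$ where $d(T)=D_0+D_1T$ with constants given by $$D_0=\frac{C_f}{|M|}+\frac{|p_s(0)|+\sqrt{2mH_0}\,(1+\varepsilon)}{e|M|},\qquad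 D_1=\sqrt{\frac{2H_0}{m}}\cdot\frac{D_{\mathcal{C}}}{|M|(1-\varepsilon)}+\frac{2H_0K'N}{e|M|(1-\varepsilon)} .$$
   Context: $\mathbb{R}^2$ carries the Euclidean metric. The particle has mass $m$ and charge $e$. Magnetic equations of motion: writing $\mathbf{B}=b(x,y)\,dx\wedge dy$ in Cartesian coordinates, a solution is a curve $q(t)$ in $\Omega$ with $m\ddot q=-e\,b(q)\,J\dot q$, where $J=\left(\begin{smallmatrix}0&-1\\1&0\end{smallmatrix}\right)$. Normal coordinates: let $L$ be the length of $\mathcal{C}$ and $\gamma:\mathbb{R}/L\mathbb{Z}\to\mathcal{C}$ an arc length parametrization; let $\nu(s)$ be the unit normal to $\mathcal{C}$ at $\gamma(s)$ pointing into $\Omega$, and $\kappa(s)$ the curvature, with $\ddot\gamma(s)=\kappa(s)\nu(s)$. Define $x:(0,N)\times\mathbb{R}/L\mathbb{Z}\to\Omega$ by $x(n,s)=\gamma(s)+n\nu(s)$. For small enough $N>0$ the map $x$ is a diffeomorphism onto its image, which is denoted $\Omega_{\mathcal{C}}(N)\subset\Omega$ (a collar neighborhood of $\mathcal{C}$); this is what is meant by normal coordinates being defined on $\Omega_{\mathcal{C}}(N)$. In these coordinates the Euclidean metric is $dn^2+(1-\kappa(s)n)^2ds^2$. Potential, energy and momentum: on $\Omega_{\mathcal{C}}(N)$ use the potential $\mathbf{A}=A(n,s)\,ds$ with $A(n,s)=-\int_n^N B(u,s)\,du$, so $d\mathbf{A}=\mathbf{B}$. The equations of motion are those of the Hamiltonian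 $$H=\frac{p_n^2}{2m}+\frac{(p_s-eA(n,s))^2}{2m(1-\kappa(s)n)^2},$$ where $(n,s,p_n,p_s)$ are the cotangent coordinates induced by the normal coordinates. The energy $H_0$ is the constant value of $H$ along the solution, and $p_s(0)$ is the value of $p_s$ at $t=0$.
   Formalization: The charge is taken positive, e > 0, and "N small" is taken to include N ≤ 1; without these the displayed bound fails, since D_0 contains e without absolute value and the term C_f/|M| needs a collar of width at most 1. *)

theory Defs
  imports "HOL-Analysis.Analysis"
begin

text \<open>
  \<open>C_on k S f\<close>: \<open>f\<close> is \<open>k\<close> times continuously differentiable on \<open>S\<close>, expressed by iterated partial
  derivatives. These are two-sided derivatives, so this is meant for open \<open>S\<close> only.
\<close>

primrec C_on :: "nat \<Rightarrow> 'a::euclidean_space set \<Rightarrow> ('a \<Rightarrow> 'b::real_normed_vector) \<Rightarrow> bool" where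
  "C_on 0 S f \<longleftrightarrow> continuous_on S f"
| "C_on (Suc k) S f \<longleftrightarrow>
     (\<forall>x\<in>S. f differentiable (at x)) \<and>
     (\<forall>i\<in>Basis. C_on k S (\<lambda>x. frechet_derivative f (at x) i))"

definition smooth_on :: "'a::euclidean_space set \<Rightarrow> ('a \<Rightarrow> 'b::real_normed_vector) \<Rightarrow> bool" where
  "smooth_on S f \<longleftrightarrow> (\<forall>k. C_on k S f)"

definition diffeo_between ::
  "'a::euclidean_space set \<Rightarrow> 'b::euclidean_space set \<Rightarrow> ('a \<Rightarrow> 'b) \<Rightarrow> bool" where
  "diffeo_between S U f \<longleftrightarrow>
     open S \<and> open U \<and> smooth_on S f \<and> f ` S = U \<and>
     (\<exists>g. smooth_on U g \<and> (\<forall>x\<in>S. g (f x) = x))"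

text \<open>
  Smooth boundary in the sense of local defining functions: near every boundary point, the open set
  is the positivity set of a smooth function without critical points. In particular it lies
  locally on one side of its boundary.
\<close>

definition smooth_boundary :: "'a::euclidean_space set \<Rightarrow> bool" where
  "smooth_boundary \<Omega> \<longleftrightarrow>
     (\<forall>p\<in>frontier \<Omega>. \<exists>U (\<phi> :: 'a \<Rightarrow> real).
        open U \<and> p \<in> U \<and> smooth_on U \<phi> \<and>
        (\<forall>x\<in>U. frechet_derivative \<phi> (at x) \<noteq> (\<lambda>_. 0)) \<and>
        \<Omega> \<inter> U = {x \<in> U. \<phi> x > 0})"

definition bounded_smooth_domain :: "'a::euclidean_space set \<Rightarrow> bool" where
  "bounded_smooth_domain \<Omega> \<longleftrightarrow>
     \<Omega> \<noteq> {} \<and> open \<Omega> \<and> connected \<Omega> \<and> bounded \<Omega> \<and> smooth_boundary \<Omega>"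

text \<open>
  Functions on the circle of length \<open>L\<close> are represented by \<open>L\<close>-periodic functions on the line.
\<close>

definition arc_length_parametrization :: "real \<Rightarrow> (real^2) set \<Rightarrow> (real \<Rightarrow> real^2) \<Rightarrow> bool" where
  "arc_length_parametrization L C \<gamma> \<longleftrightarrow>
     L > 0 \<and> smooth_on UNIV \<gamma> \<and> (\<forall>s. \<gamma> (s + L) = \<gamma> s) \<and>
     (\<forall>s. norm (vector_derivative \<gamma> (at s)) = 1) \<and>
     inj_on \<gamma> {0..<L} \<and> \<gamma> ` {0..<L} = C"

definition inward_unit_normal ::
  "(real^2) set \<Rightarrow> (real \<Rightarrow> real^2) \<Rightarrow> (real \<Rightarrow> real^2) \<Rightarrow> bool" where
  "inward_unit_normal \<Omega> \<gamma> \<nu> \<longleftrightarrow>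
     (\<forall>s. norm (\<nu> s) = 1 \<and> \<nu> s \<bullet> vector_derivative \<gamma> (at s) = 0 \<and>
          (\<exists>\<delta>>0. \<forall>n. 0 < n \<and> n < \<delta> \<longrightarrow> \<gamma> s + n *\<^sub>R \<nu> s \<in> \<Omega>))"

definition curvature_function ::
  "(real \<Rightarrow> real^2) \<Rightarrow> (real \<Rightarrow> real^2) \<Rightarrow> (real \<Rightarrow> real) \<Rightarrow> bool" where
  "curvature_function \<gamma> \<nu> \<kappa> \<longleftrightarrow>
     (\<forall>s. vector_derivative (\<lambda>r. vector_derivative \<gamma> (at r)) (at s) = \<kappa> s *\<^sub>R \<nu> s)"

definition normal_map :: "(real \<Rightarrow> real^2) \<Rightarrow> (real \<Rightarrow> real^2) \<Rightarrow> real \<times> real \<Rightarrow> real^2" where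
  "normal_map \<gamma> \<nu> = (\<lambda>(n, s). \<gamma> s + n *\<^sub>R \<nu> s)"

definition collar :: "(real \<Rightarrow> real^2) \<Rightarrow> (real \<Rightarrow> real^2) \<Rightarrow> real \<Rightarrow> (real^2) set" where
  "collar \<gamma> \<nu> N = normal_map \<gamma> \<nu> ` ({0<..<N} \<times> UNIV)"

text \<open>
  The normal map on \<open>(0,N) \<times> \<real>\<close> descends to a diffeomorphism from the quotient by \<open>s \<mapsto> s + L\<close>
  onto its image: its fibres are exactly the orbits, and, the quotient map being a local
  diffeomorphism, smoothness of the map and of its inverse is tested on the covering space.
\<close>

definition normal_coordinates ::
  "(real^2) set \<Rightarrow> real \<Rightarrow> (real \<Rightarrow> real^2) \<Rightarrow> (real \<Rightarrow> real^2) \<Rightarrow> real \<Rightarrow> bool" where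
  "normal_coordinates \<Omega> L \<gamma> \<nu> N \<longleftrightarrow>
     N > 0 \<and> collar \<gamma> \<nu> N \<subseteq> \<Omega> \<and>
     smooth_on ({0<..<N} \<times> UNIV) (normal_map \<gamma> \<nu>) \<and>
     (\<forall>n\<in>{0<..<N}. \<forall>n'\<in>{0<..<N}. \<forall>s s'.
        normal_map \<gamma> \<nu> (n, s) = normal_map \<gamma> \<nu> (n', s') \<longleftrightarrow>
        n = n' \<and> (\<exists>k::int. s' = s + of_int k * L)) \<and>
     (\<forall>p\<in>{0<..<N} \<times> UNIV. \<exists>W U.
        p \<in> W \<and> W \<subseteq> {0<..<N} \<times> UNIV \<and> diffeo_between W U (normal_map \<gamma> \<nu>))"

text \<open>
  The coefficient of \<open>dn \<and> ds\<close> in the pullback of \<open>b dx \<and> dy\<close> under the normal map. Its sign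
  depends on the orientation of \<open>\<gamma>\<close>, which is not prescribed.
\<close>

definition area_form :: "real^2 \<Rightarrow> real^2 \<Rightarrow> real" where
  "area_form v w = v $ 1 * w $ 2 - v $ 2 * w $ 1"

definition normal_field ::
  "(real \<Rightarrow> real^2) \<Rightarrow> (real \<Rightarrow> real^2) \<Rightarrow> (real^2 \<Rightarrow> real) \<Rightarrow> real \<Rightarrow> real \<Rightarrow> real" where
  "normal_field \<gamma> \<nu> b n s =
     b (normal_map \<gamma> \<nu> (n, s)) *
     area_form (vector_derivative (\<lambda>u. normal_map \<gamma> \<nu> (u, s)) (at n))
               (vector_derivative (\<lambda>r. normal_map \<gamma> \<nu> (n, r)) (at s))"

definition magnetic_potential :: "real \<Rightarrow> (real \<Rightarrow> real \<Rightarrow> real) \<Rightarrow> real \<Rightarrow> real \<Rightarrow> real" where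
  "magnetic_potential N B n s = - integral {n..N} (\<lambda>u. B u s)"

definition hamiltonian ::
  "real \<Rightarrow> real \<Rightarrow> (real \<Rightarrow> real) \<Rightarrow> (real \<Rightarrow> real \<Rightarrow> real) \<Rightarrow> real \<Rightarrow> real \<Rightarrow> real \<Rightarrow> real \<Rightarrow> real" where
  "hamiltonian m e \<kappa> A n s p\<^sub>n p\<^sub>s =
     p\<^sub>n\<^sup>2 / (2 * m) + (p\<^sub>s - e * A n s)\<^sup>2 / (2 * m * (1 - \<kappa> s * n)\<^sup>2)"

definition J :: "real^2^2" where
  "J = vector [vector [0, -1], vector [1, 0]]"

definition magnetic_solution ::
  "real \<Rightarrow> real \<Rightarrow> (real^2 \<Rightarrow> real) \<Rightarrow> (real^2) set \<Rightarrow> real \<Rightarrow> (real \<Rightarrow> real^2) \<Rightarrow> bool" where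
  "magnetic_solution m e b \<Omega> T q \<longleftrightarrow>
     (\<exists>v a. \<forall>t\<in>{0..T}.
        q t \<in> \<Omega> \<and>
        (q has_vector_derivative v t) (at t within {0..T}) \<and>
        (v has_vector_derivative a t) (at t within {0..T}) \<and>
        m *\<^sub>R a t = - (e * b (q t)) *\<^sub>R (J *v v t))"

text \<open>
  The momenta along a curve \<open>(n, s)\<close> are the cotangent coordinates corresponding to its velocity
  under the Legendre transform, i.e. \<open>n' = \<partial>H/\<partial>p\<^sub>n\<close> and \<open>s' = \<partial>H/\<partial>p\<^sub>s\<close>.
\<close>

definition canonical_momenta ::
  "(real \<Rightarrow> real \<Rightarrow> real \<Rightarrow> real \<Rightarrow> real) \<Rightarrow> real \<Rightarrow>
   (real \<Rightarrow> real) \<Rightarrow> (real \<Rightarrow> real) \<Rightarrow> (real \<Rightarrow> real) \<Rightarrow> (real \<Rightarrow> real) \<Rightarrow> bool" where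
  "canonical_momenta H T n s p\<^sub>n p\<^sub>s \<longleftrightarrow>
     (\<forall>t\<in>{0..T}.
        (n has_real_derivative deriv (\<lambda>p. H (n t) (s t) p (p\<^sub>s t)) (p\<^sub>n t)) (at t within {0..T}) \<and>
        (s has_real_derivative deriv (\<lambda>p. H (n t) (s t) (p\<^sub>n t) p) (p\<^sub>s t)) (at t within {0..T}))"

end

theory Submission
  imports Defs "HOL-Library.Periodic_Fun"
begin

text \<open>
  Along a solution \<open>p\<^sub>s' = - m w \<kappa>' n s'\<^sup>2 - e s' \<integral>\<^sub>n\<^sup>N \<partial>\<^sub>s f du\<close> with \<open>w = 1 - \<kappa> n\<close>: the singular part of the
  field does not depend on \<open>s\<close> and cancels. The speed \<open>\<bar>w s'\<bar>\<close> is at most \<open>sqrt (2 H\<^sub>0 / m)\<close> because the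
  kinetic energy is constant, so \<open>p\<^sub>s\<close> grows at most linearly in time. Since also
  \<open>\<bar>p\<^sub>s - e A\<bar> = m w \<bar>w s'\<bar>\<close> is bounded, so is \<open>A\<close>, and with it \<open>\<bar>M\<bar> \<integral>\<^sub>n\<^sup>N u\<^sup>-\<^sup>\<alpha> du\<close>; solving for \<open>n\<close> gives the
  estimate.
\<close>

section \<open>Calculus: integrals with a moving limit and periodic functions\<close>

text \<open>The function is the composite of \<open>t \<mapsto> (s t, n t)\<close> with
  \<open>(r, y) \<mapsto> integral {y..c} (\<lambda>u. g u r)\<close>. The latter is totally
  differentiable because its partial derivative in y, given by the fundamental theorem of calculus,
  is jointly continuous; for the one in r the Leibniz rule at the point in question
  suffices.\<close>

lemma has_real_derivative_integral_moving_limit: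
  fixes g g' :: "real \<Rightarrow> real \<Rightarrow> real" and n s :: "real \<Rightarrow> real"
  assumes g: "continuous_on ({a..c} \<times> UNIV) (\<lambda>(u, r). g u r)"
    and dg: "\<And>u r. u \<in> {a..c} \<Longrightarrow> (g u has_real_derivative g' u r) (at r)"
    and g': "continuous_on ({a..c} \<times> UNIV) (\<lambda>(u, r). g' u r)"
    and t: "t \<in> X" and nX: "n ` X \<subseteq> {a..c}"
    and dn: "(n has_real_derivative n') (at t within X)"
    and ds: "(s has_real_derivative s') (at t within X)"
  shows "((\<lambda>t. integral {n t..c} (\<lambda>u. g u (s t))) has_real_derivative
           s' * integral {n t..c} (\<lambda>u. g' u (s t)) - n' * g (n t) (s t)) (at t within X)"
proof -
  have gu: "continuous_on {a..c} (\<lambda>u. g u r)" for r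
    by (rule continuous_on_compose2[OF g, where f="\<lambda>u. (u, r)" and s="{a..c}", simplified])
      (auto intro!: continuous_intros)
  \<comment> \<open>The Leibniz rule and the criterion by partial derivatives both take the
    parameter r as the first coordinate.\<close>
  have swap: "continuous_on (UNIV \<times> {a..c}) (\<lambda>(r, u). k u r)"
    if "continuous_on ({a..c} \<times> UNIV) (\<lambda>(u, r). k u r)" for k :: "real \<Rightarrow> real \<Rightarrow> real"
  proof -
    have "continuous_on (UNIV \<times> {a..c}) (\<lambda>p. (\<lambda>(u, r). k u r) (prod.swap p))"
      using that by (rule continuous_on_compose2) (auto intro: continuous_on_swap)
    then show ?thesis by (simp add: case_prod_unfold prod.swap_def)
  qed
  have nt: "n t \<in> {a..c}" using t nX by auto
  let ?F = "\<lambda>(r, y). integral {y..c} (\<lambda>u. g u r)"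
  have "(?F has_derivative (\<lambda>(tx, ty). tx * integral {n t..c} (\<lambda>u. g' u (s t)) +
          blinfun_mult_right (- g (n t) (s t)) ty)) (at (s t, n t) within UNIV \<times> {a..c})"
  proof (rule has_derivative_partialsI)
    have "((\<lambda>r. integral (cbox (n t) c) (\<lambda>u. g u r)) has_field_derivative
        integral (cbox (n t) c) (\<lambda>u. g' u (s t))) (at (s t) within UNIV)"
    proof (rule leibniz_rule_field_derivative)
      show "((\<lambda>r. g u r) has_field_derivative g' u r) (at r within UNIV)"
        if "u \<in> cbox (n t) c" for r u
        using dg[of u r] that nt by auto
      show "(\<lambda>u. g u r) integrable_on cbox (n t) c" for r
        using gu nt by (intro integrable_continuous continuous_on_subset[OF gu]) auto
      show "continuous_on (UNIV \<times> cbox (n t) c) (\<lambda>(r, u). g' u r)"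
        using nt by (intro continuous_on_subset[OF swap[OF g']]) auto
    qed auto
    then show "((\<lambda>r. integral {n t..c} (\<lambda>u. g u r)) has_derivative
        (\<lambda>tx. tx * integral {n t..c} (\<lambda>u. g' u (s t)))) (at (s t) within UNIV)"
      by (simp add: has_field_derivative_def mult_commute_abs)
    show "((\<lambda>y. integral {y..c} (\<lambda>u. g u r)) has_derivative
        blinfun_apply (blinfun_mult_right (- g y r))) (at y within {a..c})"
      if "y \<in> {a..c}" for r y
      using integral_has_real_derivative'[OF gu that]
      by (simp add: has_field_derivative_def)
    have "continuous_on (UNIV \<times> {a..c}) (\<lambda>(r, y). g y r)"
      by (rule swap[OF g])
    then have "continuous_on (UNIV \<times> {a..c}) (\<lambda>(r, y). blinfun_mult_right (- g y r))"
      by (auto simp: case_prod_unfold intro!: continuous_intros)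
    then show "continuous (at (s t, n t) within UNIV \<times> {a..c}) (\<lambda>(r, y). blinfun_mult_right (- g y r))"
      using nt by (auto simp: continuous_on_eq_continuous_within)
  qed (use nt in auto)
  then have "(?F has_derivative (\<lambda>(tx, ty). tx * integral {n t..c} (\<lambda>u. g' u (s t)) +
          blinfun_mult_right (- g (n t) (s t)) ty)) (at (s t, n t) within (\<lambda>t. (s t, n t)) ` X)"
    by (rule has_derivative_subset) (use nX in auto)
  moreover have "((\<lambda>t. (s t, n t)) has_derivative (\<lambda>h. (s' * h, n' * h))) (at t within X)"
    using dn ds unfolding has_field_derivative_def by (rule has_derivative_Pair[rotated])
  ultimately have "((\<lambda>t. ?F (s t, n t)) has_derivative (\<lambda>h. (\<lambda>(tx, ty). tx * integral {n t..c} (\<lambda>u. g' u (s t)) +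
          blinfun_mult_right (- g (n t) (s t)) ty) (s' * h, n' * h))) (at t within X)"
    by (rule has_derivative_in_compose[rotated])
  then show ?thesis
    unfolding has_field_derivative_def prod.case
    by (rule has_derivative_eq_rhs) (auto simp: fun_eq_iff algebra_simps)
qed

text \<open>Makes the suprema \<open>K\<close> and \<open>K'\<close> of the theorem genuine bounds,
  since \<open>SUP\<close> over an unbounded set of reals says nothing. One compact period controls
  the whole line.\<close>

lemma periodic_continuous_bounded:
  fixes h :: "real \<Rightarrow> real"
  assumes "continuous_on UNIV h" and per: "\<And>r. h (r + L) = h r" and "L > 0"
  shows "bdd_above (range (\<lambda>r. \<bar>h r\<bar>))"
proof -
  interpret periodic_fun_simple h L by standard (rule per)
  have "compact (h ` {0..L})"
    using assms by (intro compact_continuous_image continuous_on_subset[OF assms(1)]) auto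
  then obtain D where D: "\<And>r. r \<in> {0..L} \<Longrightarrow> \<bar>h r\<bar> \<le> D"
    using compact_imp_bounded[of "h ` {0..L}"] unfolding bounded_iff by fastforce
  have "\<bar>h r\<bar> \<le> D" for r
  proof -
    define r' where "r' = r - of_int \<lfloor>r / L\<rfloor> * L"
    have "of_int \<lfloor>r / L\<rfloor> * L \<le> r" "r \<le> (of_int \<lfloor>r / L\<rfloor> + 1) * L"
      using floor_divide_lower[OF \<open>L > 0\<close>, of r] floor_divide_upper[OF \<open>L > 0\<close>, of r] by auto
    then have "r' \<in> {0..L}" by (auto simp: r'_def algebra_simps)
    moreover have "h r' = h r" unfolding r'_def by (rule minus_of_int)
    ultimately show ?thesis using D by metis
  qed
  then show ?thesis by (auto intro!: bdd_aboveI)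
qed

section \<open>Derivatives of maps that are smooth in the sense of \<open>smooth_on\<close>\<close>

lemma smooth_on_differentiable:
  "smooth_on S f \<Longrightarrow> x \<in> S \<Longrightarrow> (f has_derivative frechet_derivative f (at x)) (at x)"
  by (metis C_on.simps(2) frechet_derivative_works smooth_on_def)

lemma smooth_on_frechet_derivative:
  "smooth_on S f \<Longrightarrow> i \<in> Basis \<Longrightarrow> smooth_on S (\<lambda>x. frechet_derivative f (at x) i)"
  unfolding smooth_on_def by (metis C_on.simps(2))

lemma smooth_on_continuous: "smooth_on S f \<Longrightarrow> continuous_on S f"
  by (metis C_on.simps(1) smooth_on_def)

lemma smooth_curve_has_vector_derivative:
  fixes c :: "real \<Rightarrow> 'b::real_normed_vector"
  assumes "smooth_on UNIV c"
  shows "(c has_vector_derivative vector_derivative c (at r)) (at r)"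
  using smooth_on_differentiable[OF assms] vector_derivative_works
  by (metis UNIV_I differentiable_def)

lemma smooth_curve_vector_derivative:
  fixes c :: "real \<Rightarrow> 'b::real_normed_vector"
  assumes "smooth_on UNIV c"
  shows "smooth_on UNIV (\<lambda>r. vector_derivative c (at r))"
proof -
  have "frechet_derivative c (at r) 1 = vector_derivative c (at r)" for r
    using smooth_on_differentiable[OF assms] frechet_derivative_eq_vector_derivative
    by (metis UNIV_I differentiable_def scaleR_one)
  then show ?thesis
    using smooth_on_frechet_derivative[OF assms, of 1] by simp
qed

text \<open>The Frechet derivative in the direction (0, 1) is the partial derivative in the second
  variable, and smoothness of that component gives joint continuity. This serves both the normal map
  and the bounded part f of the field.\<close>

lemma smooth_on_snd_partial:
  fixes F :: "real \<times> real \<Rightarrow> 'b::real_normed_vector"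
  assumes F: "smooth_on (I \<times> UNIV) F"
  shows "u \<in> I \<Longrightarrow> ((\<lambda>r. F (u, r)) has_vector_derivative vector_derivative (\<lambda>r. F (u, r)) (at r)) (at r)"
    and "continuous_on (I \<times> UNIV) (\<lambda>(u, r). vector_derivative (\<lambda>r. F (u, r)) (at r))"
proof -
  have D: "((\<lambda>r. F (u, r)) has_vector_derivative frechet_derivative F (at (u, r)) (0, 1)) (at r)"
    if "u \<in> I" for u r
  proof -
    have "((\<lambda>r. (u, r)) has_vector_derivative (0, 1)) (at r within UNIV)"
      by (auto intro!: derivative_eq_intros)
    moreover have "(F has_derivative frechet_derivative F (at (u, r))) (at (u, r) within range (Pair u))"
      using smooth_on_differentiable[OF F, of "(u, r)"] that
      by (auto intro: has_derivative_at_withinI)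
    ultimately show ?thesis
      using vector_derivative_diff_chain_within[of "\<lambda>r. (u, r)" "(0, 1)" r UNIV F] by (simp add: o_def)
  qed
  then show "u \<in> I \<Longrightarrow> ((\<lambda>r. F (u, r)) has_vector_derivative vector_derivative (\<lambda>r. F (u, r)) (at r)) (at r)"
    using vector_derivative_at by metis
  have "(0, 1) \<in> (Basis :: (real \<times> real) set)" by (simp add: Basis_prod_def)
  from smooth_on_continuous[OF smooth_on_frechet_derivative[OF F this]]
  show "continuous_on (I \<times> UNIV) (\<lambda>(u, r). vector_derivative (\<lambda>r. F (u, r)) (at r))"
    by (rule continuous_on_cong[THEN iffD1, rotated -1]) (auto simp: vector_derivative_at[OF D])
qed

section \<open>The moving frame of the boundary curve\<close>

text \<open>The vectors a and b form an orthonormal basis of the plane, so only the b-component of z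
  survives. This is how the derivative of \<nu> becomes a multiple of the tangent.\<close>

lemma orthonormal_real2:
  fixes a b z :: "real^2"
  assumes "norm a = 1" "norm b = 1" "a \<bullet> b = 0" "z \<bullet> a = 0"
  shows "z = (z \<bullet> b) *\<^sub>R b"
proof -
  have a: "a $ 1 * a $ 1 + a $ 2 * a $ 2 = 1" and b: "b $ 1 * b $ 1 + b $ 2 * b $ 2 = 1"
    and ab: "a $ 1 * b $ 1 + a $ 2 * b $ 2 = 0" and za: "z $ 1 * a $ 1 + z $ 2 * a $ 2 = 0"
    using assms by (simp_all add: norm_eq_1 inner_vec_def sum_2)
  have "z $ 1 = (z $ 1 * b $ 1 + z $ 2 * b $ 2) * b $ 1"
    "z $ 2 = (z $ 1 * b $ 1 + z $ 2 * b $ 2) * b $ 2"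
    using a b ab za by algebra+
  then show ?thesis
    by (simp add: vec_eq_iff forall_2 inner_vec_def sum_2)
qed

lemma has_vector_derivative_inner:
  assumes "(f has_vector_derivative f') (at t within X)" "(g has_vector_derivative g') (at t within X)"
  shows "((\<lambda>t. f t \<bullet> g t) has_real_derivative f t \<bullet> g' + f' \<bullet> g t) (at t within X)"
  using bounded_bilinear.has_vector_derivative[OF bounded_bilinear_inner assms]
  by (simp add: has_real_derivative_iff_has_vector_derivative)

lemma vector_derivative_periodic:
  fixes c :: "real \<Rightarrow> 'b::real_normed_vector"
  assumes "\<And>r. (c has_vector_derivative c' r) (at r)" "\<And>r. c (r + L) = c r"
  shows "c' (r + L) = c' r"
proof -
  have "((\<lambda>r. r + L) has_vector_derivative 1) (at r)"
    by (auto intro!: derivative_eq_intros)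
  then have "((\<lambda>r. c (r + L)) has_vector_derivative 1 *\<^sub>R c' (r + L)) (at r)"
    using vector_diff_chain_at[of "\<lambda>r. r + L" 1 r c "c' (r + L)"] assms(1) by (simp add: o_def)
  then show ?thesis
    using assms by (simp add: vector_derivative_unique_at)
qed

text \<open>The Frenet equations of a plane curve, with curvature measured against \<nu>. As the
  orientation of the curve is not prescribed, only orthonormality of \<tau> and \<nu> is
  recorded.\<close>

locale normal_frame =
  fixes \<gamma> \<tau> \<nu> :: "real \<Rightarrow> real^2" and \<kappa> \<kappa>' :: "real \<Rightarrow> real"
  assumes curve: "\<And>r. (\<gamma> has_vector_derivative \<tau> r) (at r)"
    and tangent: "\<And>r. (\<tau> has_vector_derivative \<kappa> r *\<^sub>R \<nu> r) (at r)"
    and normal: "\<And>r. (\<nu> has_vector_derivative - \<kappa> r *\<^sub>R \<tau> r) (at r)"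
    and curvature: "\<And>r. (\<kappa> has_real_derivative \<kappa>' r) (at r)"
    and norms: "\<And>r. norm (\<tau> r) = 1" "\<And>r. norm (\<nu> r) = 1"
    and orthogonal: "\<And>r. \<nu> r \<bullet> \<tau> r = 0"

text \<open>The inward normal is given only pointwise. It is differentiable because the coordinate
  line of the normal map at distance N / 2 is smooth, and \<nu> is 2 / N times the difference of
  that line and \<gamma>. The two bounds then follow from continuity and periodicity of \<kappa> and
  its derivative.\<close>

lemma normal_coordinates_frame:
  assumes arc: "arc_length_parametrization L C \<gamma>"
    and inw: "inward_unit_normal \<Omega> \<gamma> \<nu>" and curv: "curvature_function \<gamma> \<nu> \<kappa>"
    and coords: "normal_coordinates \<Omega> L \<gamma> \<nu> N"
  shows "normal_frame \<gamma> (\<lambda>r. vector_derivative \<gamma> (at r)) \<nu> \<kappa> (deriv \<kappa>)"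
    and "bdd_above (range (\<lambda>r. \<bar>\<kappa> r\<bar>))" and "bdd_above (range (\<lambda>r. \<bar>deriv \<kappa> r\<bar>))"
proof -
  define \<tau> where "\<tau> r = vector_derivative \<gamma> (at r)" for r
  define a where "a r = vector_derivative \<tau> (at r)" for r
  define a' where "a' r = vector_derivative a (at r)" for r
  define F where "F = normal_map \<gamma> \<nu>"
  define F' where "F' r = vector_derivative (\<lambda>r. F (N / 2, r)) (at r)" for r
  define \<nu>' where "\<nu>' r = (2 / N) *\<^sub>R (F' r - \<tau> r)" for r
  define \<kappa>' where "\<kappa>' r = a r \<bullet> \<nu>' r + a' r \<bullet> \<nu> r" for r
  have \<gamma>: "smooth_on UNIV \<gamma>" and "L > 0" and per_\<gamma>: "\<gamma> (r + L) = \<gamma> r" and n\<tau>: "norm (\<tau> r) = 1" for r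
    using arc by (auto simp: arc_length_parametrization_def \<tau>_def)
  have n\<nu>: "norm (\<nu> r) = 1" and ort: "\<nu> r \<bullet> \<tau> r = 0" for r
    using inw by (auto simp: inward_unit_normal_def \<tau>_def)
  have a_eq: "a r = \<kappa> r *\<^sub>R \<nu> r" for r
    using curv by (simp add: curvature_function_def a_def \<tau>_def[abs_def])
  have "N > 0" and F: "smooth_on ({0<..<N} \<times> UNIV) F"
    and fib: "\<And>u r. u \<in> {0<..<N} \<Longrightarrow> F (u, r) = F (u, r + L)"
    using coords unfolding normal_coordinates_def F_def
    by (simp, simp, elim conjE, metis mult_1 of_int_1)
  have F_eq: "F (N / 2, r) = \<gamma> r + (N / 2) *\<^sub>R \<nu> r" for r
    by (simp add: F_def normal_map_def)
  have sm\<tau>: "smooth_on UNIV \<tau>"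
    using smooth_curve_vector_derivative[OF \<gamma>] by (simp add: \<tau>_def[abs_def])
  have sma: "smooth_on UNIV a"
    using smooth_curve_vector_derivative[OF sm\<tau>] by (simp add: a_def[abs_def])
  have sma': "smooth_on UNIV a'"
    using smooth_curve_vector_derivative[OF sma] by (simp add: a'_def[abs_def])
  have d\<gamma>: "(\<gamma> has_vector_derivative \<tau> r) (at r)"
    and d\<tau>: "(\<tau> has_vector_derivative a r) (at r)"
    and da: "(a has_vector_derivative a' r) (at r)" for r
    using smooth_curve_has_vector_derivative \<gamma> sm\<tau> sma by (auto simp: \<tau>_def a_def a'_def)
  have dF: "((\<lambda>r. F (N / 2, r)) has_vector_derivative F' r) (at r)" for r
    using smooth_on_snd_partial(1)[OF F] \<open>N > 0\<close> by (auto simp: F'_def)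
  have \<nu>_eq: "\<nu> = (\<lambda>r. (2 / N) *\<^sub>R (F (N / 2, r) - \<gamma> r))"
    using \<open>N > 0\<close> by (auto simp: F_eq)
  have d\<nu>: "(\<nu> has_vector_derivative \<nu>' r) (at r)" for r
    unfolding \<nu>'_def by (subst \<nu>_eq) (auto intro!: derivative_eq_intros dF d\<gamma>)
  have "continuous_on UNIV (\<lambda>r. (\<lambda>(u, r). vector_derivative (\<lambda>r. F (u, r)) (at r)) (N / 2, r))"
    by (rule continuous_on_compose2[OF smooth_on_snd_partial(2)[OF F]])
      (use \<open>N > 0\<close> in \<open>auto intro!: continuous_intros\<close>)
  then have "continuous_on UNIV F'" by (simp add: F'_def[abs_def])
  then have cont_\<nu>': "continuous_on UNIV \<nu>'"
    unfolding \<nu>'_def[abs_def] by (intro continuous_intros \<open>continuous_on UNIV F'\<close> smooth_on_continuous[OF sm\<tau>])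
  have cont_\<nu>: "continuous_on UNIV \<nu>"
    using d\<nu> by (meson continuous_at_imp_continuous_on has_vector_derivative_continuous)
  \<comment> \<open>Differentiating the constants \<nu> \<bullet> \<nu> = 1 and \<nu> \<bullet>
    \<tau> = 0 yields the two components of \<open>\<nu>'\<close> in the frame.\<close>
  have \<nu>\<nu>': "\<nu>' r \<bullet> \<nu> r = 0" for r
  proof -
    have "((\<lambda>r. \<nu> r \<bullet> \<nu> r) has_real_derivative \<nu> r \<bullet> \<nu>' r + \<nu>' r \<bullet> \<nu> r) (at r)"
      by (rule has_vector_derivative_inner[OF d\<nu> d\<nu>])
    moreover have "\<nu> r \<bullet> \<nu> r = 1" for r using n\<nu>[of r] by (simp add: norm_eq_1)
    ultimately show ?thesis
      using DERIV_unique[OF _ DERIV_const] by (fastforce simp: inner_commute)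
  qed
  have \<tau>\<nu>': "\<nu>' r \<bullet> \<tau> r = - \<kappa> r" for r
  proof -
    have "((\<lambda>r. \<nu> r \<bullet> \<tau> r) has_real_derivative \<nu> r \<bullet> a r + \<nu>' r \<bullet> \<tau> r) (at r)"
      by (rule has_vector_derivative_inner[OF d\<nu> d\<tau>])
    then have "\<nu> r \<bullet> a r + \<nu>' r \<bullet> \<tau> r = 0"
      using DERIV_unique[OF _ DERIV_const] by (fastforce simp: ort)
    moreover have "\<nu> r \<bullet> \<nu> r = 1" using n\<nu>[of r] by (simp add: norm_eq_1)
    ultimately show ?thesis by (simp add: a_eq)
  qed
  have \<nu>'_eq: "\<nu>' r = - \<kappa> r *\<^sub>R \<tau> r" for r
    using orthonormal_real2[OF n\<nu> n\<tau> ort \<nu>\<nu>'] by (simp only: \<tau>\<nu>')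
  \<comment> \<open>Pairing the curvature equation with \<nu> exhibits \<kappa> as an inner product
    of differentiable curves.\<close>
  have \<kappa>_eq: "\<kappa> = (\<lambda>r. a r \<bullet> \<nu> r)"
    using n\<nu> by (auto simp: a_eq norm_eq_1)
  have d\<kappa>: "(\<kappa> has_real_derivative \<kappa>' r) (at r)" for r
    unfolding \<kappa>'_def by (subst \<kappa>_eq) (rule has_vector_derivative_inner[OF da d\<nu>])
  then have deriv_\<kappa>: "deriv \<kappa> = \<kappa>'"
    by (auto intro: DERIV_imp_deriv)
  have per_\<tau>: "\<tau> (r + L) = \<tau> r" for r by (rule vector_derivative_periodic[OF d\<gamma> per_\<gamma>])
  have per_a: "a (r + L) = a r" for r by (rule vector_derivative_periodic[OF d\<tau> per_\<tau>])
  \<comment> \<open>The fibres of the normal map contain the shift by one period, and \<gamma> is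
    periodic, so \<nu> must be periodic too.\<close>
  have per_\<nu>: "\<nu> (r + L) = \<nu> r" for r
    using fib[of "N / 2" r] \<open>N > 0\<close> by (simp add: F_eq per_\<gamma>)
  have per_\<kappa>: "\<kappa> (r + L) = \<kappa> r" for r by (simp add: \<kappa>_eq per_a per_\<nu>)
  have per_\<kappa>': "\<kappa>' (r + L) = \<kappa>' r" for r
    using d\<kappa> by (intro vector_derivative_periodic[of \<kappa>, OF _ per_\<kappa>])
      (simp add: has_real_derivative_iff_has_vector_derivative)
  show "normal_frame \<gamma> (\<lambda>r. vector_derivative \<gamma> (at r)) \<nu> \<kappa> (deriv \<kappa>)"
    using d\<gamma> d\<tau> d\<nu> d\<kappa> n\<tau> n\<nu> ort
    by unfold_locales (auto simp: a_eq \<nu>'_eq deriv_\<kappa> \<tau>_def[symmetric])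
  show "bdd_above (range (\<lambda>r. \<bar>\<kappa> r\<bar>))"
    by (rule periodic_continuous_bounded[of \<kappa>, OF _ per_\<kappa> \<open>L > 0\<close>])
      (meson DERIV_isCont continuous_at_imp_continuous_on d\<kappa>)
  have "continuous_on UNIV \<kappa>'"
    unfolding \<kappa>'_def[abs_def]
    by (intro continuous_intros smooth_on_continuous[OF sma] smooth_on_continuous[OF sma'] cont_\<nu> cont_\<nu>')
  then show "bdd_above (range (\<lambda>r. \<bar>deriv \<kappa> r\<bar>))"
    unfolding deriv_\<kappa> by (rule periodic_continuous_bounded[of \<kappa>', OF _ per_\<kappa>' \<open>L > 0\<close>])
qed

context normal_frame
begin

text \<open>The factor in the Euclidean metric dn^2 + width^2 ds^2.\<close>

abbreviation width :: "real \<Rightarrow> real \<Rightarrow> real" where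
  "width u r \<equiv> 1 - \<kappa> r * u"

lemma normal_map_partials:
  "((\<lambda>u. normal_map \<gamma> \<nu> (u, r)) has_vector_derivative \<nu> r) (at u)"
  "((\<lambda>r. normal_map \<gamma> \<nu> (u, r)) has_vector_derivative width u r *\<^sub>R \<tau> r) (at r)"
  by (auto simp: normal_map_def scaleR_left.diff mult.commute
      intro!: derivative_eq_intros curve normal)

text \<open>The orientation sign \<open>area_form (\<nu> r) (\<tau> r)\<close> stays unevaluated:
  the tangential magnetic force carries the same factor, so the two match for either
  orientation.\<close>

lemma normal_field_eq:
  "normal_field \<gamma> \<nu> b u r =
     b (normal_map \<gamma> \<nu> (u, r)) * (width u r * area_form (\<nu> r) (\<tau> r))"
  unfolding normal_field_def vector_derivative_at[OF normal_map_partials(1)]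
    vector_derivative_at[OF normal_map_partials(2)]
  by (simp add: area_form_def algebra_simps)

end

section \<open>Motion in normal coordinates: energy and momentum\<close>

text \<open>Only Newton's equation and the coordinates of q enter here, no Hamiltonian. Derivatives
  are taken within {0..T}, and T > 0 makes them unique, so that v can be computed from n and
  s.\<close>

locale magnetic_motion = normal_frame +
  fixes m e T :: real and b :: "real^2 \<Rightarrow> real" and q v a :: "real \<Rightarrow> real^2"
    and n s n' s' :: "real \<Rightarrow> real"
  assumes mass: "m > 0" and time: "T > 0"
    and dq: "\<And>t. t \<in> {0..T} \<Longrightarrow> (q has_vector_derivative v t) (at t within {0..T})"
    and dv: "\<And>t. t \<in> {0..T} \<Longrightarrow> (v has_vector_derivative a t) (at t within {0..T})"
    and newton: "\<And>t. t \<in> {0..T} \<Longrightarrow> m *\<^sub>R a t = - (e * b (q t)) *\<^sub>R (J *v v t)"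
    and dn: "\<And>t. t \<in> {0..T} \<Longrightarrow> (n has_real_derivative n' t) (at t within {0..T})"
    and ds: "\<And>t. t \<in> {0..T} \<Longrightarrow> (s has_real_derivative s' t) (at t within {0..T})"
    and q_eq: "\<And>t. t \<in> {0..T} \<Longrightarrow> q t = normal_map \<gamma> \<nu> (n t, s t)"
begin

lemma along:
  assumes "\<And>r. (c has_vector_derivative c' r) (at r)" "t \<in> {0..T}"
  shows "((\<lambda>t. c (s t)) has_vector_derivative s' t *\<^sub>R c' (s t)) (at t within {0..T})"
proof -
  have "(s has_vector_derivative s' t) (at t within {0..T})"
    using ds[OF assms(2)] by (simp add: has_real_derivative_iff_has_vector_derivative)
  from vector_diff_chain_within[OF this, of c] show ?thesis
    using assms(1) has_vector_derivative_at_within by (fastforce simp: o_def)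
qed

lemma curvature_along:
  assumes "t \<in> {0..T}"
  shows "((\<lambda>t. \<kappa> (s t)) has_real_derivative s' t * \<kappa>' (s t)) (at t within {0..T})"
  using along[of \<kappa> \<kappa>' t] curvature assms by (simp add: has_real_derivative_iff_has_vector_derivative)

lemma velocity:
  assumes t: "t \<in> {0..T}"
  shows "v t = n' t *\<^sub>R \<nu> (s t) + (width (n t) (s t) * s' t) *\<^sub>R \<tau> (s t)"
proof (rule vector_derivative_unique_within_closed_interval[of 0 T t q])
  have "(n has_vector_derivative n' t) (at t within {0..T})"
    using dn[OF t] by (simp add: has_real_derivative_iff_has_vector_derivative)
  then have "((\<lambda>t. \<gamma> (s t) + n t *\<^sub>R \<nu> (s t)) has_vector_derivative
      n' t *\<^sub>R \<nu> (s t) + (width (n t) (s t) * s' t) *\<^sub>R \<tau> (s t)) (at t within {0..T})"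
    by (auto intro!: derivative_eq_intros along[OF curve t] along[OF normal t] dn[OF t]
        simp: algebra_simps)
  then show "(q has_vector_derivative n' t *\<^sub>R \<nu> (s t) + (width (n t) (s t) * s' t) *\<^sub>R \<tau> (s t))
      (at t within cbox 0 T)"
    unfolding box_real
    by (rule has_vector_derivative_transform[OF t, rotated]) (simp add: q_eq normal_map_def)
qed (use t time dq in auto)

lemma velocity_components:
  assumes "t \<in> {0..T}"
  shows "v t \<bullet> \<nu> (s t) = n' t" "v t \<bullet> \<tau> (s t) = width (n t) (s t) * s' t"
    "v t \<bullet> v t = (n' t)\<^sup>2 + (width (n t) (s t) * s' t)\<^sup>2"
proof -
  have *: "\<nu> r \<bullet> \<nu> r = 1" "\<tau> r \<bullet> \<tau> r = 1" "\<nu> r \<bullet> \<tau> r = 0" "\<tau> r \<bullet> \<nu> r = 0" for r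
    using norms orthogonal by (auto simp: norm_eq_1 inner_commute)
  show "v t \<bullet> \<nu> (s t) = n' t" "v t \<bullet> \<tau> (s t) = width (n t) (s t) * s' t"
    "v t \<bullet> v t = (n' t)\<^sup>2 + (width (n t) (s t) * s' t)\<^sup>2"
    by (simp_all add: velocity[OF assms] inner_add_left inner_add_right * power2_eq_square)
qed

lemma J_mult: "(J *v x) \<bullet> y = area_form x y"
  by (simp add: J_def matrix_vector_mult_def inner_vec_def sum_2 area_form_def vector_2)

text \<open>The force is a multiple of \<open>J *v v t\<close>, which is orthogonal to the velocity,
  and so does no work.\<close>

lemma kinetic_energy_constant:
  assumes t: "t \<in> {0..T}"
  shows "v t \<bullet> v t = v 0 \<bullet> v 0"
proof -
  have "((\<lambda>t. v t \<bullet> v t) has_real_derivative 0) (at t within {0..T})" if t: "t \<in> {0..T}" for t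
  proof -
    have "m * (a t \<bullet> v t) = (m *\<^sub>R a t) \<bullet> v t" by simp
    also have "\<dots> = 0"
      unfolding newton[OF t] by (simp add: J_mult area_form_def)
    finally have "a t \<bullet> v t = 0" using mass by simp
    then show ?thesis
      using has_vector_derivative_inner[OF dv[OF t] dv[OF t]] by (simp add: inner_commute)
  qed
  then obtain c where "\<And>t. t \<in> {0..T} \<Longrightarrow> v t \<bullet> v t = c"
    using has_field_derivative_zero_constant[of "{0..T}" "\<lambda>t. v t \<bullet> v t"] by auto
  then show ?thesis using t time by simp
qed

text \<open>The quantity is the kinetic momentum \<open>p\<^sub>s - e A\<close>, written as m times
  width times the tangential velocity. In the product rule, the turning of \<tau> and the \<kappa>
  n' part of the change of width cancel; what remains is the magnetic force and a term in
  \<kappa>'.\<close>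

lemma kinetic_momentum_derivative:
  assumes t: "t \<in> {0..T}"
  shows "((\<lambda>t. m * (width (n t) (s t))\<^sup>2 * s' t) has_real_derivative
      - (e * normal_field \<gamma> \<nu> b (n t) (s t) * n' t
        + m * width (n t) (s t) * \<kappa>' (s t) * n t * (s' t)\<^sup>2)) (at t within {0..T})"
proof -
  let ?w = "width (n t) (s t)"
  have "m * (a t \<bullet> \<tau> (s t)) = (m *\<^sub>R a t) \<bullet> \<tau> (s t)" by simp
  also have "\<dots> = - (e * b (q t)) * area_form (v t) (\<tau> (s t))"
    unfolding newton[OF t] by (simp add: J_mult)
  also have "area_form (v t) (\<tau> (s t)) = n' t * area_form (\<nu> (s t)) (\<tau> (s t))"
    by (simp add: velocity[OF t] area_form_def algebra_simps)
  finally have force: "?w * (m * (a t \<bullet> \<tau> (s t))) = - (e * normal_field \<gamma> \<nu> b (n t) (s t) * n' t)"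
    by (simp add: normal_field_eq q_eq[OF t])
  have "((\<lambda>t. m * (width (n t) (s t) * (v t \<bullet> \<tau> (s t)))) has_real_derivative
      m * (?w * (v t \<bullet> (s' t *\<^sub>R \<kappa> (s t) *\<^sub>R \<nu> (s t)) + a t \<bullet> \<tau> (s t))
        - (s' t * \<kappa>' (s t) * n t + n' t * \<kappa> (s t)) * (v t \<bullet> \<tau> (s t)))) (at t within {0..T})"
    by (auto intro!: derivative_eq_intros has_vector_derivative_inner[OF dv[OF t] along[OF tangent t]]
        curvature_along[OF t] dn[OF t] simp: algebra_simps)
  moreover have "m * (?w * (v t \<bullet> (s' t *\<^sub>R \<kappa> (s t) *\<^sub>R \<nu> (s t)) + a t \<bullet> \<tau> (s t))
        - (s' t * \<kappa>' (s t) * n t + n' t * \<kappa> (s t)) * (v t \<bullet> \<tau> (s t)))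
      = - (e * normal_field \<gamma> \<nu> b (n t) (s t) * n' t + m * ?w * \<kappa>' (s t) * n t * (s' t)\<^sup>2)"
    using force by (simp add: velocity_components[OF t] algebra_simps power2_eq_square)
  ultimately have "((\<lambda>t. m * (width (n t) (s t) * (v t \<bullet> \<tau> (s t)))) has_real_derivative
      - (e * normal_field \<gamma> \<nu> b (n t) (s t) * n' t + m * ?w * \<kappa>' (s t) * n t * (s' t)\<^sup>2)) (at t within {0..T})"
    by simp
  then show ?thesis
    unfolding has_real_derivative_iff_has_vector_derivative
    by (rule has_vector_derivative_transform[OF t, rotated])
      (simp add: velocity_components power2_eq_square)
qed

end

context magnetic_motion
begin

text \<open>\<open>P\<close> is the canonical momentum for the potential cut off at c. The moving
  lower limit contributes e n' g(n, s), which cancels the magnetic force, so \<open>P'\<close>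
  contains the field only through its s-derivative. Energy conservation bounds \<open>P'\<close>,
  and the mean value inequality gives the linear growth.\<close>

lemma momentum_drift:
  fixes g g' :: "real \<Rightarrow> real \<Rightarrow> real"
  assumes "e > 0" "\<epsilon> < 1"
    and field: "\<And>t. t \<in> {0..T} \<Longrightarrow> normal_field \<gamma> \<nu> b (n t) (s t) = g (n t) (s t)"
    and g: "continuous_on ({l..c} \<times> UNIV) (\<lambda>(u, r). g u r)"
    and dg: "\<And>u r. u \<in> {l..c} \<Longrightarrow> (g u has_real_derivative g' u r) (at r)"
    and g': "continuous_on ({l..c} \<times> UNIV) (\<lambda>(u, r). g' u r)"
    and n: "n ` {0..T} \<subseteq> {l..c}" and "0 \<le> l" "c \<le> N"
    and D: "\<And>t. t \<in> {0..T} \<Longrightarrow> integral {n t..c} (\<lambda>u. \<bar>g' u (s t)\<bar>) \<le> D"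
    and K': "\<And>r. \<bar>\<kappa>' r\<bar> \<le> K'"
    and w: "\<And>t. t \<in> {0..T} \<Longrightarrow> 1 - \<epsilon> \<le> width (n t) (s t)"
    and H: "2 * H\<^sub>0 = m * (v 0 \<bullet> v 0)"
    and P: "\<And>t. P t = m * (width (n t) (s t))\<^sup>2 * s' t - e * integral {n t..c} (\<lambda>u. g u (s t))"
    and t: "t \<in> {0..T}"
  shows "\<bar>P t - P 0\<bar> \<le>
    (2 * H\<^sub>0 * K' * N / (1 - \<epsilon>) + e * (sqrt (2 * H\<^sub>0 / m) / (1 - \<epsilon>) * D)) * t"
proof -
  let ?R = "2 * H\<^sub>0 * K' * N / (1 - \<epsilon>) + e * (sqrt (2 * H\<^sub>0 / m) / (1 - \<epsilon>) * D)"
  let ?P' = "\<lambda>t. - (m * width (n t) (s t) * \<kappa>' (s t) * n t * (s' t)\<^sup>2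
    + e * (s' t * integral {n t..c} (\<lambda>u. g' u (s t))))"
  have dP: "(P has_real_derivative ?P' t) (at t within {0..T})" if t: "t \<in> {0..T}" for t
  proof -
    have "(P has_real_derivative
      - (e * normal_field \<gamma> \<nu> b (n t) (s t) * n' t + m * width (n t) (s t) * \<kappa>' (s t) * n t * (s' t)\<^sup>2)
      - e * (s' t * integral {n t..c} (\<lambda>u. g' u (s t)) - n' t * g (n t) (s t))) (at t within {0..T})"
      unfolding P[abs_def]
      by (intro DERIV_diff DERIV_cmult kinetic_momentum_derivative[OF t]
          has_real_derivative_integral_moving_limit[OF g dg g' t n dn[OF t] ds[OF t]])
    then show ?thesis by (simp add: field[OF t] algebra_simps)
  qed
  have "\<bar>?P' t\<bar> \<le> ?R" if t: "t \<in> {0..T}" for t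
  proof -
    \<comment> \<open>The tangential component of the velocity; m S^2 is at most twice the
      energy.\<close>
    define S where "S = width (n t) (s t) * s' t"
    have nt: "0 \<le> n t" "n t \<le> N" "n t \<in> {l..c}"
    proof -
      show "n t \<in> {l..c}" using n t by blast
      then show "0 \<le> n t" "n t \<le> N" using \<open>0 \<le> l\<close> \<open>c \<le> N\<close> by auto
    qed
    have w0: "0 < 1 - \<epsilon>" "0 < width (n t) (s t)" using w[OF t] \<open>\<epsilon> < 1\<close> by auto
    have "m * S\<^sup>2 \<le> m * (v 0 \<bullet> v 0)"
      using velocity_components(3)[OF t] kinetic_energy_constant[OF t] mass by (simp add: S_def)
    then have mS: "m * S\<^sup>2 \<le> 2 * H\<^sub>0" using H by simp
    then have S: "\<bar>S\<bar> \<le> sqrt (2 * H\<^sub>0 / m)"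
      using mass by (intro real_le_rsqrt) (simp add: field_simps)
    have "\<bar>s' t\<bar> = \<bar>S\<bar> / width (n t) (s t)" using w0 by (simp add: S_def abs_mult)
    then have s': "\<bar>s' t\<bar> \<le> sqrt (2 * H\<^sub>0 / m) / (1 - \<epsilon>)"
      using frac_le[OF order_trans[OF abs_ge_zero S] S w0(1) w[OF t]] by simp
    have "continuous_on {l..c} (\<lambda>u. g' u (s t))"
      by (rule continuous_on_compose2[OF g', where f="\<lambda>u. (u, s t)" and s="{l..c}", simplified])
        (auto intro!: continuous_intros)
    then have c: "continuous_on {n t..c} (\<lambda>u. g' u (s t))"
      using nt by (auto elim!: continuous_on_subset)
    have "norm (integral {n t..c} (\<lambda>u. g' u (s t))) \<le> integral {n t..c} (\<lambda>u. \<bar>g' u (s t)\<bar>)"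
      by (rule integral_norm_bound_integral)
        (auto intro!: integrable_continuous_real continuous_intros c)
    then have I: "\<bar>integral {n t..c} (\<lambda>u. g' u (s t))\<bar> \<le> D"
      using D[OF t] by simp
    \<comment> \<open>Since s' = S / width, the product of width and s'^2 is S^2 / width: only the
      first power of 1 - \<epsilon> is lost.\<close>
    have "\<bar>m * width (n t) (s t) * \<kappa>' (s t) * n t * (s' t)\<^sup>2\<bar>
        = (m * S\<^sup>2) * \<bar>\<kappa>' (s t)\<bar> * n t / width (n t) (s t)"
      using w0 nt mass by (simp add: S_def abs_mult power2_eq_square)
    also have "\<dots> \<le> (2 * H\<^sub>0) * K' * N / (1 - \<epsilon>)"
    proof (rule frac_le)
      have 0: "0 \<le> m * S\<^sup>2" using mass by simp
      have 1: "(m * S\<^sup>2) * \<bar>\<kappa>' (s t)\<bar> \<le> (2 * H\<^sub>0) * K'"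
        by (rule mult_mono[OF mS K' order_trans[OF 0 mS] abs_ge_zero])
      have 2: "0 \<le> (m * S\<^sup>2) * \<bar>\<kappa>' (s t)\<bar>" by (rule mult_nonneg_nonneg[OF 0 abs_ge_zero])
      show "(m * S\<^sup>2) * \<bar>\<kappa>' (s t)\<bar> * n t \<le> (2 * H\<^sub>0) * K' * N"
        by (rule mult_mono[OF 1 nt(2) order_trans[OF 2 1] nt(1)])
      then show "0 \<le> (2 * H\<^sub>0) * K' * N"
        using mult_nonneg_nonneg[OF 2 nt(1)] by linarith
    qed (use w0 w[OF t] in auto)
    finally have 1: "\<bar>m * width (n t) (s t) * \<kappa>' (s t) * n t * (s' t)\<^sup>2\<bar> \<le> 2 * H\<^sub>0 * K' * N / (1 - \<epsilon>)" .
    have "\<bar>e * (s' t * integral {n t..c} (\<lambda>u. g' u (s t)))\<bar> \<le> e * (sqrt (2 * H\<^sub>0 / m) / (1 - \<epsilon>) * D)"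
      using s' I \<open>e > 0\<close> unfolding abs_mult
      by (intro mult_mono) (auto intro: order_trans[OF abs_ge_zero])
    with 1 show ?thesis by linarith
  qed
  then have "norm (P t - P 0) \<le> ?R * norm (t - 0)"
    using time t by (intro field_differentiable_bound[OF _ dP]) auto
  then show ?thesis using t by simp
qed

end

section \<open>Integrals across the collar\<close>

text \<open>The function f is controlled only for u < N, while the potential integrates up to N. The
  end point is a null set, and bounded continuous functions on the half-open interval are
  integrable.\<close>

lemma bounded_continuous_integrable:
  fixes h :: "real \<Rightarrow> real"
  assumes "continuous_on {x..<N} h" "\<And>u. u \<in> {x..<N} \<Longrightarrow> \<bar>h u\<bar> \<le> D"
  shows "h integrable_on {x..N}"
proof -
  have "h integrable_on {x..<N}"
  proof (rule measurable_bounded_by_integrable_imp_integrable)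
    show "h \<in> borel_measurable (lebesgue_on {x..<N})"
      by (intro continuous_imp_measurable_on_sets_lebesgue assms(1)) simp
    show "(\<lambda>u. D) integrable_on {x..<N}"
      by (intro integrable_on_const bounded_set_imp_lmeasurable) auto
  qed (use assms(2) in auto)
  moreover have "negligible ({x..N} - {x..<N})" "negligible ({x..<N} - {x..N})"
    by (auto intro: negligible_subset[of "{N}"])
  ultimately show ?thesis
    by (subst integrable_spike_set_eq[of _ "{x..<N}"])
      (auto intro!: negligible_subset[of "{N}" "sym_diff {x..N} {x..<N}"])
qed

lemma integral_abs_le:
  fixes h :: "real \<Rightarrow> real"
  assumes "h integrable_on {x..N}" "x \<le> N" "0 \<le> D" "\<And>u. u \<in> {x..<N} \<Longrightarrow> \<bar>h u\<bar> \<le> D"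
  shows "\<bar>integral {x..N} h\<bar> \<le> D * (N - x)"
  using has_integral_bound_real[of D "{N}" h "integral {x..N} h" x N] assms
  by (auto simp: integrable_integral)

text \<open>The integral is evaluated by an explicit antiderivative, a power or the logarithm.
  Solving for x uses that a power with negative exponent is decreasing, or that exp is
  increasing.\<close>

lemma integral_powr_lower_bound:
  fixes x N \<alpha> d :: real
  assumes "0 < x" "x < N" "1 \<le> \<alpha>" and I: "integral {x..N} (\<lambda>u. 1 / u powr \<alpha>) \<le> d"
  shows "x \<ge> (if \<alpha> > 1 then (N powr (- (\<alpha> - 1)) + (\<alpha> - 1) * d) powr (- 1 / (\<alpha> - 1))
     else N * exp (- d))"
proof (cases "\<alpha> > 1")
  case True
  \<comment> \<open>Normalizes the derivative of the antiderivative and, for p = 1, the product of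
    the two exponents.\<close>
  have eq: "- ((1 - \<alpha>) / (p * (\<alpha> - 1))) = 1 / p" for p
    using True by (cases "p = 0") (simp_all add: divide_simps)
  have "((\<lambda>u. 1 / u powr \<alpha>) has_integral
      - (N powr (- (\<alpha> - 1)) / (\<alpha> - 1)) - - (x powr (- (\<alpha> - 1)) / (\<alpha> - 1))) {x..N}"
  proof (rule fundamental_theorem_of_calculus)
    show "((\<lambda>u. - (u powr (- (\<alpha> - 1)) / (\<alpha> - 1))) has_vector_derivative 1 / u powr \<alpha>)
        (at u within {x..N})" if "u \<in> {x..N}" for u
      unfolding has_real_derivative_iff_has_vector_derivative[symmetric]
      using that assms True
      by (auto intro!: derivative_eq_intros simp: powr_minus_divide eq)
  qed (use assms in auto)
  then have "(x powr (- (\<alpha> - 1)) - N powr (- (\<alpha> - 1))) / (\<alpha> - 1) \<le> d"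
    using I by (simp add: integral_unique diff_divide_distrib)
  then have "x powr (- (\<alpha> - 1)) \<le> N powr (- (\<alpha> - 1)) + (\<alpha> - 1) * d"
    using True by (simp add: field_simps)
  then have "(N powr (- (\<alpha> - 1)) + (\<alpha> - 1) * d) powr (- 1 / (\<alpha> - 1))
      \<le> (x powr (- (\<alpha> - 1))) powr (- 1 / (\<alpha> - 1))"
    using True assms by (intro powr_mono2') auto
  also have "\<dots> = x" using assms True eq[of 1] by (simp add: powr_powr)
  finally show ?thesis using True by simp
next
  case False
  then have [simp]: "\<alpha> = 1" using assms by simp
  have "((\<lambda>u. 1 / u powr \<alpha>) has_integral ln N - ln x) {x..N}"
  proof (rule fundamental_theorem_of_calculus)
    show "(ln has_vector_derivative 1 / u powr \<alpha>) (at u within {x..N})" if "u \<in> {x..N}" for u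
      unfolding has_real_derivative_iff_has_vector_derivative[symmetric]
      using that assms by (auto intro!: derivative_eq_intros)
  qed (use assms in auto)
  then have "ln N - d \<le> ln x" using I by (simp add: integral_unique)
  then have "exp (ln N - d) \<le> x" using assms by (simp add: ln_ge_iff)
  then show ?thesis using assms by (simp add: exp_diff exp_minus divide_inverse)
qed

section \<open>The lower bound for the distance to the boundary component\<close>

theorem theorem2:
  fixes \<Omega> C :: "(real^2) set" and b :: "real^2 \<Rightarrow> real"
    and m e M \<alpha> \<epsilon> L N K K' C\<^sub>f D\<^sub>C H\<^sub>0 T D\<^sub>0 D\<^sub>1 :: real
    and \<gamma> \<nu> :: "real \<Rightarrow> real^2" and \<kappa> :: "real \<Rightarrow> real"
    and f B A :: "real \<Rightarrow> real \<Rightarrow> real"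
    and H :: "real \<Rightarrow> real \<Rightarrow> real \<Rightarrow> real \<Rightarrow> real"
    and q :: "real \<Rightarrow> real^2" and n s p\<^sub>n p\<^sub>s d :: "real \<Rightarrow> real"
  assumes "m > 0" and "e > 0"
    and "bounded_smooth_domain \<Omega>" and "smooth_on \<Omega> b" and "C \<in> components (frontier \<Omega>)"
    and "arc_length_parametrization L C \<gamma>"
    and "inward_unit_normal \<Omega> \<gamma> \<nu>" and "curvature_function \<gamma> \<nu> \<kappa>"
    and "K = (SUP r. \<bar>\<kappa> r\<bar>)" and "K' = (SUP r. \<bar>deriv \<kappa> r\<bar>)"
    and "normal_coordinates \<Omega> L \<gamma> \<nu> N" and "N \<le> 1"
    and "0 < \<epsilon>" and "\<epsilon> < 1" and "N < \<epsilon> / K"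
    and "B = normal_field \<gamma> \<nu> b"
    and "\<alpha> \<ge> 1" and "M \<noteq> 0"
    and "\<And>u r. u \<in> {0<..<N} \<Longrightarrow> B u r = M / u powr \<alpha> + f u r"
    and "smooth_on ({0<..<N} \<times> UNIV) (\<lambda>(u, r). f u r)"
    and "\<And>u r. u \<in> {0<..<N} \<Longrightarrow> \<bar>f u r\<bar> \<le> C\<^sub>f"
    and "\<And>r. (\<lambda>u. deriv (f u) r) absolutely_integrable_on {0<..<N}"
    and "\<And>r. integral {0<..<N} (\<lambda>u. \<bar>deriv (f u) r\<bar>) \<le> D\<^sub>C"
    and "A = magnetic_potential N B" and "H = hamiltonian m e \<kappa> A"
    and "magnetic_solution m e b \<Omega> T q"
    and "\<And>t. t \<in> {0..T} \<Longrightarrow> n t \<in> {0<..<N} \<and> q t = normal_map \<gamma> \<nu> (n t, s t)"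
    and "canonical_momenta H T n s p\<^sub>n p\<^sub>s"
    and "H\<^sub>0 = H (n 0) (s 0) (p\<^sub>n 0) (p\<^sub>s 0)"
    and "D\<^sub>0 = C\<^sub>f / \<bar>M\<bar> + (\<bar>p\<^sub>s 0\<bar> + sqrt (2 * m * H\<^sub>0) * (1 + \<epsilon>)) / (e * \<bar>M\<bar>)"
    and "D\<^sub>1 = sqrt (2 * H\<^sub>0 / m) * (D\<^sub>C / (\<bar>M\<bar> * (1 - \<epsilon>)))
              + 2 * H\<^sub>0 * K' * N / (e * \<bar>M\<bar> * (1 - \<epsilon>))"
    and "\<And>t. d t = D\<^sub>0 + D\<^sub>1 * t"
  shows "\<forall>t\<in>{0..T}.
           n t \<ge> (if \<alpha> > 1
                   then (N powr (- (\<alpha> - 1)) + (\<alpha> - 1) * d T) powr (- 1 / (\<alpha> - 1))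
                   else N * exp (- d T))"
proof
  fix t assume t: "t \<in> {0..T}"
  \<comment> \<open>The bound for the rate of change of \<open>p\<^sub>s\<close>; it equals
    \<open>e * \<bar>M\<bar> * D\<^sub>1\<close>.\<close>
  define R where "R = 2 * H\<^sub>0 * K' * N / (1 - \<epsilon>) + e * (sqrt (2 * H\<^sub>0 / m) / (1 - \<epsilon>) * D\<^sub>C)"
  interpret normal_frame \<gamma> "\<lambda>r. vector_derivative \<gamma> (at r)" \<nu> \<kappa> "deriv \<kappa>"
    by (rule normal_coordinates_frame[OF assms(6,7,8,11)])
  have "N > 0" using assms(11) by (simp add: normal_coordinates_def)
  have \<kappa>_le: "\<bar>\<kappa> r\<bar> \<le> K" and \<kappa>'_le: "\<bar>deriv \<kappa> r\<bar> \<le> K'" for r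
    using normal_coordinates_frame(2,3)[OF assms(6,7,8,11)]
    by (auto simp: assms(9,10) intro!: cSUP_upper)
  have "0 \<le> K" using \<kappa>_le[of 0] by linarith
  \<comment> \<open>For K = 0 the quotient \<epsilon> / K would be 0 by convention, contradicting 0
    < N < \<epsilon> / K.\<close>
  then have "K > 0" using assms(15) \<open>N > 0\<close> by (cases "K = 0") auto
  then have "K * N < \<epsilon>" using assms(15) by (simp add: field_simps)
  then have w: "1 - \<epsilon> \<le> width u r" "width u r \<le> 1 + \<epsilon>" if "u \<in> {0<..<N}" for u r
  proof -
    have "\<bar>\<kappa> r * u\<bar> \<le> K * N"
      using that \<kappa>_le[of r] \<open>0 \<le> K\<close> by (auto simp: abs_mult intro!: mult_mono)
    then show "1 - \<epsilon> \<le> width u r" "width u r \<le> 1 + \<epsilon>" using \<open>K * N < \<epsilon>\<close> by linarith+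
  qed
  have nN: "n t \<in> {0<..<N}" if "t \<in> {0..T}" for t using assms(27) that by blast
  have "C\<^sub>f \<ge> 0" using assms(21)[of "N / 2" 0] \<open>N > 0\<close> by auto

  have df: "(f u has_real_derivative deriv (f u) r) (at r)" if "u \<in> {0<..<N}" for u r
    using smooth_on_snd_partial(1)[OF assms(20) that, of r]
    by (simp add: has_real_derivative_iff_has_vector_derivative[symmetric] DERIV_imp_deriv)
  have deriv_f: "vector_derivative (f u) (at r) = deriv (f u) r" if "u \<in> {0<..<N}" for u r
    using df[OF that, of r]
    by (simp add: has_real_derivative_iff_has_vector_derivative vector_derivative_at)
  have abs_int: "(\<lambda>u. \<bar>deriv (f u) r\<bar>) integrable_on {0<..<N}" for r
    using assms(22)[of r] by (simp add: absolutely_integrable_on_def)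
  have cont_f: "continuous_on ({0<..<N} \<times> UNIV) (\<lambda>(u, r). f u r)"
    by (rule smooth_on_continuous[OF assms(20)])
  have cont_f': "continuous_on ({0<..<N} \<times> UNIV) (\<lambda>(u, r). deriv (f u) r)"
    by (rule continuous_on_cong[THEN iffD1, OF refl _ smooth_on_snd_partial(2)[OF assms(20)]])
      (auto simp: deriv_f)
  have cont_fu: "continuous_on {0<..<N} (\<lambda>u. f u r)" for r
    by (rule continuous_on_compose2[OF cont_f, where f="\<lambda>u. (u, r)" and s="{0<..<N}", simplified])
      (auto intro!: continuous_intros)
  have f_int: "(\<lambda>u. f u r) integrable_on {x..N}" if "0 < x" for x r
    by (rule bounded_continuous_integrable[where D=C\<^sub>f])
      (use that assms(21) in \<open>auto intro!: continuous_on_subset[OF cont_fu]\<close>)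
  have p_int: "(\<lambda>u. 1 / u powr \<alpha>) integrable_on {x..N}" if "0 < x" for x
    using that by (intro integrable_continuous_real continuous_intros) auto
  have B_integral: "((\<lambda>u. B u r) has_integral
      M * integral {x..N} (\<lambda>u. 1 / u powr \<alpha>) + integral {x..N} (\<lambda>u. f u r)) {x..N}"
    if "0 < x" for x r
  proof (rule has_integral_spike[of "{N}"])
    show "((\<lambda>u. M * (1 / u powr \<alpha>) + f u r) has_integral
        M * integral {x..N} (\<lambda>u. 1 / u powr \<alpha>) + integral {x..N} (\<lambda>u. f u r)) {x..N}"
      by (intro has_integral_add has_integral_mult_right integrable_integral p_int f_int that)
  qed (use that assms(19) in auto)
  have A_eq: "A x r = - M * integral {x..N} (\<lambda>u. 1 / u powr \<alpha>) - integral {x..N} (\<lambda>u. f u r)"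
    if "0 < x" for x r
    using B_integral[OF that, of r] by (simp add: assms(24) magnetic_potential_def integral_unique)
  have f_small: "\<bar>integral {x..N} (\<lambda>u. f u r)\<bar> \<le> C\<^sub>f * (N - x)" if "0 < x" "x \<le> N" for x r
    by (rule integral_abs_le[OF f_int]) (use that assms(21) \<open>C\<^sub>f \<ge> 0\<close> in auto)

  have motion: "H (n t) (s t) (p\<^sub>n t) (p\<^sub>s t) = H\<^sub>0 \<and> \<bar>p\<^sub>s t - p\<^sub>s 0\<bar> \<le> R * t"
  proof (cases "T > 0")
    \<comment> \<open>Here T = 0, whereas the locale used below asks for an interval of positive
      length.\<close>
    case False
    then have "t = 0" using t by auto
    then show ?thesis using assms(29) by simp
  next
    case True
    obtain v a where sol: "\<And>t. t \<in> {0..T} \<Longrightarrow> (q has_vector_derivative v t) (at t within {0..T})"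
      "\<And>t. t \<in> {0..T} \<Longrightarrow> (v has_vector_derivative a t) (at t within {0..T})"
      "\<And>t. t \<in> {0..T} \<Longrightarrow> m *\<^sub>R a t = - (e * b (q t)) *\<^sub>R (J *v v t)"
      using assms(26) unfolding magnetic_solution_def by blast
    \<comment> \<open>The explicit values of the derivatives of H in \<open>p\<^sub>n\<close> and
      \<open>p\<^sub>s\<close>.\<close>
    define n' where "n' t = p\<^sub>n t / m" for t
    define s' where "s' t = (p\<^sub>s t - e * A (n t) (s t)) / (m * (width (n t) (s t))\<^sup>2)" for t
    have w0: "width (n t) (s t) > 0" if "t \<in> {0..T}" for t
      using w(1)[OF nN[OF that], of "s t"] assms(14) by linarith
    have "deriv (\<lambda>p. H (n t) (s t) p (p\<^sub>s t)) (p\<^sub>n t) = n' t" for t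
      unfolding assms(25) hamiltonian_def n'_def
      using assms(1) by (intro DERIV_imp_deriv) (auto intro!: derivative_eq_intros)
    moreover have "deriv (\<lambda>p. c + (p - k)\<^sup>2 / (2 * z)) x = (x - k) / z" if "z > 0" for c k x z :: real
      by (intro DERIV_imp_deriv) (use that in \<open>auto intro!: derivative_eq_intros simp: field_simps\<close>)
    from this[of "m * (width (n t) (s t))\<^sup>2" _ "e * A (n t) (s t)" "p\<^sub>s t" for t]
    have "deriv (\<lambda>p. H (n t) (s t) (p\<^sub>n t) p) (p\<^sub>s t) = s' t" if "t \<in> {0..T}" for t
      unfolding assms(25) hamiltonian_def s'_def
      using w0[OF that] assms(1) by (simp add: mult.assoc)
    ultimately have ham: "(n has_real_derivative n' t) (at t within {0..T})"
      "(s has_real_derivative s' t) (at t within {0..T})" if "t \<in> {0..T}" for t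
      using assms(28) that unfolding canonical_momenta_def by auto
    interpret magnetic_motion \<gamma> "\<lambda>r. vector_derivative \<gamma> (at r)" \<nu> \<kappa> "deriv \<kappa>" m e T b q v a n s n' s'
      by unfold_locales (use assms(1,27) True sol ham in auto)
    have p\<^sub>s_eq: "p\<^sub>s t = m * (width (n t) (s t))\<^sup>2 * s' t + e * A (n t) (s t)" if "t \<in> {0..T}" for t
      using w0[OF that] assms(1) by (simp add: s'_def)
    \<comment> \<open>In terms of velocities H is the kinetic energy, so its conservation follows
      from that of the speed.\<close>
    have H_eq: "2 * H (n t) (s t) (p\<^sub>n t) (p\<^sub>s t) = m * (v 0 \<bullet> v 0)" if "t \<in> {0..T}" for t
    proof -
      have "2 * ((m * x)\<^sup>2 / (2 * m) + (m * z\<^sup>2 * y)\<^sup>2 / (2 * m * z\<^sup>2)) = m * (x\<^sup>2 + (z * y)\<^sup>2)"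
        if "z > 0" for x y z
        using that assms(1) by (simp add: field_simps power2_eq_square)
      from this[OF w0[OF that], of "n' t" "s' t"] assms(1) show ?thesis
        unfolding kinetic_energy_constant[OF that, symmetric] velocity_components(3)[OF that] p\<^sub>s_eq[OF that]
        by (simp add: assms(25) hamiltonian_def n'_def)
    qed
    have "0 \<in> {0..T}" using True by simp
    have H0: "2 * H\<^sub>0 = m * (v 0 \<bullet> v 0)" using H_eq[OF \<open>0 \<in> {0..T}\<close>] by (simp add: assms(29))
    \<comment> \<open>By compactness n stays in a closed subinterval of (0, N): away from the
      singularity at 0 and with room for a cutoff below N.\<close>
    have "continuous_on {0..T} n"
      by (rule DERIV_continuous_on[OF ham(1)])
    moreover have "compact {0..T}" "{0..T} \<noteq> {}" using True by auto
    ultimately obtain t\<^sub>1 t\<^sub>2 where t12: "t\<^sub>1 \<in> {0..T}" "t\<^sub>2 \<in> {0..T}"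
      "\<And>t. t \<in> {0..T} \<Longrightarrow> n t\<^sub>1 \<le> n t \<and> n t \<le> n t\<^sub>2"
      using continuous_attains_inf[of "{0..T}" n] continuous_attains_sup[of "{0..T}" n] by blast
    define g where "g u r = M / u powr \<alpha> + f u r" for u r
    \<comment> \<open>Near \<open>u = N\<close> the derivative of \<open>f\<close> is only integrable, so the potential is differentiated along
      the motion with the upper limit \<open>N\<close> replaced by some \<open>c < N\<close>.\<close>
    have drift: "\<bar>p\<^sub>s t - p\<^sub>s 0\<bar> \<le> R * t + 2 * e * C\<^sub>f * (N - c)" if c: "n t\<^sub>2 \<le> c" "c < N" for c
    proof -
      define P where "P t = m * (width (n t) (s t))\<^sup>2 * s' t - e * integral {n t..c} (\<lambda>u. g u (s t))" for t
      have sub: "{n t\<^sub>1..c} \<subseteq> {0<..<N}" using nN[OF t12(1)] c by auto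
      then have sub': "{n t\<^sub>1..c} \<times> UNIV \<subseteq> {0<..<N} \<times> (UNIV :: real set)" by auto
      have P: "\<bar>P t - P 0\<bar> \<le> R * t"
        unfolding R_def
      proof (rule momentum_drift[where l="n t\<^sub>1" and c=c and g=g and g'="\<lambda>u. deriv (f u)"])
        show "normal_field \<gamma> \<nu> b (n t) (s t) = g (n t) (s t)" if "t \<in> {0..T}" for t
          using assms(19)[OF nN[OF that]] by (simp add: assms(16) g_def)
        show "continuous_on ({n t\<^sub>1..c} \<times> UNIV) (\<lambda>(u, r). g u r)"
          using sub continuous_on_subset[OF cont_f sub'] unfolding g_def case_prod_unfold
          by (intro continuous_intros) auto
        show "(g u has_real_derivative deriv (f u) r) (at r)" if "u \<in> {n t\<^sub>1..c}" for u r
          using DERIV_add[OF DERIV_const[of "M / u powr \<alpha>"] df[of u r]] that sub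
          by (auto simp: g_def[abs_def])
        show "continuous_on ({n t\<^sub>1..c} \<times> UNIV) (\<lambda>(u, r). deriv (f u) r)"
          by (rule continuous_on_subset[OF cont_f' sub'])
        show "integral {n t..c} (\<lambda>u. \<bar>deriv (f u) (s t)\<bar>) \<le> D\<^sub>C" if t: "t \<in> {0..T}" for t
        proof -
          have *: "{n t..c} \<subseteq> {0<..<N}" using nN[OF t] c by auto
          then have "(\<lambda>u. \<bar>deriv (f u) (s t)\<bar>) integrable_on {n t..c}"
            using integrable_on_subinterval[OF abs_int[of "s t"], of "n t" c] by simp
          from integral_subset_le[OF * this abs_int[of "s t"]] assms(23)[of "s t"] show ?thesis by simp
        qed
        show "n ` {0..T} \<subseteq> {n t\<^sub>1..c}" using t12(3) c by force
        show "0 \<le> n t\<^sub>1" "c \<le> N" using nN[OF t12(1)] c by auto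
        show "1 - \<epsilon> \<le> width (n t) (s t)" if "t \<in> {0..T}" for t by (rule w(1)[OF nN[OF that]])
      qed (fact assms(2) assms(14) \<kappa>'_le H0 P_def t)+
      \<comment> \<open>The tail of the singular part over {c..N} depends on neither t nor s and
        drops out of the difference of momenta. Only two tails of f remain, each at most
        \<open>C\<^sub>f * (N - c)\<close>.\<close>
      have A_cut: "A (n t) (s t) = - integral {n t..c} (\<lambda>u. g u (s t))
          - M * integral {c..N} (\<lambda>u. 1 / u powr \<alpha>) - integral {c..N} (\<lambda>u. f u (s t))"
        if t: "t \<in> {0..T}" for t
      proof -
        have "0 < n t" "n t \<le> c" "c \<le> N" "0 < c"
          using nN[OF t] t12(3)[OF t] c by auto
        have "A (n t) (s t) = - (integral {n t..c} (\<lambda>u. B u (s t)) + integral {c..N} (\<lambda>u. B u (s t)))"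
          using Henstock_Kurzweil_Integration.integral_combine[OF \<open>n t \<le> c\<close> \<open>c \<le> N\<close>
              has_integral_integrable[OF B_integral[OF \<open>0 < n t\<close>, of "s t"]]]
          by (simp add: assms(24) magnetic_potential_def)
        also have "integral {n t..c} (\<lambda>u. B u (s t)) = integral {n t..c} (\<lambda>u. g u (s t))"
          using \<open>0 < n t\<close> c by (intro integral_cong) (auto simp: g_def assms(19))
        finally show ?thesis
          using B_integral[OF \<open>0 < c\<close>, of "s t"] by (simp add: integral_unique)
      qed
      have "p\<^sub>s t - p\<^sub>s 0 = (P t - P 0)
          + e * (integral {c..N} (\<lambda>u. f u (s 0)) - integral {c..N} (\<lambda>u. f u (s t)))"
        unfolding p\<^sub>s_eq[OF t] p\<^sub>s_eq[OF \<open>0 \<in> {0..T}\<close>] A_cut[OF t] A_cut[OF \<open>0 \<in> {0..T}\<close>] P_def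
        by (simp add: algebra_simps)
      moreover have "0 < c" "c \<le> N" using nN[OF t12(2)] c by auto
      then have "\<bar>integral {c..N} (\<lambda>u. f u (s 0)) - integral {c..N} (\<lambda>u. f u (s t))\<bar> \<le> 2 * (C\<^sub>f * (N - c))"
        using f_small[of c "s 0"] f_small[of c "s t"] by linarith
      then have "\<bar>e * (integral {c..N} (\<lambda>u. f u (s 0)) - integral {c..N} (\<lambda>u. f u (s t)))\<bar>
          \<le> e * (2 * (C\<^sub>f * (N - c)))"
        using assms(2) by (simp add: abs_mult)
      moreover have "e * (2 * (C\<^sub>f * (N - c))) = 2 * e * C\<^sub>f * (N - c)" by simp
      ultimately show ?thesis using P by linarith
    qed
    \<comment> \<open>Letting c tend to N from below removes the cutoff error.\<close>
    have "\<bar>p\<^sub>s t - p\<^sub>s 0\<bar> \<le> R * t"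
    proof (rule tendsto_lowerbound)
      have "((\<lambda>c. R * t + 2 * e * C\<^sub>f * (N - c)) \<longlongrightarrow> R * t + 2 * e * C\<^sub>f * (N - N)) (at_left N)"
        by (intro tendsto_intros)
      then show "((\<lambda>c. R * t + 2 * e * C\<^sub>f * (N - c)) \<longlongrightarrow> R * t) (at_left N)" by simp
      show "\<forall>\<^sub>F c in at_left N. \<bar>p\<^sub>s t - p\<^sub>s 0\<bar> \<le> R * t + 2 * e * C\<^sub>f * (N - c)"
        unfolding eventually_at_left_field
        using drift nN[OF t12(2)] by (intro exI[of _ "n t\<^sub>2"]) auto
    qed simp
    moreover have "H (n t) (s t) (p\<^sub>n t) (p\<^sub>s t) = H\<^sub>0" using H_eq[OF t] H0 by simp
    ultimately show ?thesis by blast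
  qed

  \<comment> \<open>Allows R t to be replaced by R T.\<close>
  have "R \<ge> 0"
  proof -
    have "0 \<le> integral {0<..<N} (\<lambda>u. \<bar>deriv (f u) 0\<bar>)"
      by (rule integral_nonneg[OF abs_int]) simp
    then have "D\<^sub>C \<ge> 0" using assms(23)[of 0] by linarith
    moreover have "H\<^sub>0 \<ge> 0" using assms(1) by (simp add: assms(25,29) hamiltonian_def)
    moreover have "K' \<ge> 0" using \<kappa>'_le[of 0] by linarith
    ultimately show ?thesis using assms(1,2,14) \<open>N > 0\<close> by (simp add: R_def)
  qed
  let ?I = "integral {n t..N} (\<lambda>u. 1 / u powr \<alpha>)"
  define y where "y = p\<^sub>s t - e * A (n t) (s t)"
  have nt: "0 < n t" "n t < N" using nN[OF t] by auto
  \<comment> \<open>The energy contains y^2 / (2 m width^2) next to a nonnegative term, and width is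
    at most 1 + \<epsilon>.\<close>
  have "\<bar>y\<bar> \<le> sqrt (2 * m * H\<^sub>0) * (1 + \<epsilon>)"
  proof -
    let ?w = "width (n t) (s t)"
    have w0: "0 < ?w" "?w \<le> 1 + \<epsilon>" using w[OF nN[OF t], of "s t"] assms(14) by auto
    have "(p\<^sub>n t)\<^sup>2 / (2 * m) + y\<^sup>2 / (2 * m * ?w\<^sup>2) = H\<^sub>0"
      using motion by (simp add: assms(25) hamiltonian_def y_def)
    moreover have "(p\<^sub>n t)\<^sup>2 / (2 * m) \<ge> 0" using assms(1) by simp
    ultimately have "y\<^sup>2 / (2 * m * ?w\<^sup>2) \<le> H\<^sub>0" by linarith
    then have "y\<^sup>2 / ?w\<^sup>2 \<le> 2 * m * H\<^sub>0"
      using assms(1) w0 by (simp add: field_simps)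
    then have "\<bar>y / ?w\<bar> \<le> sqrt (2 * m * H\<^sub>0)"
      by (intro real_le_rsqrt) (simp add: power_divide)
    then have "\<bar>y\<bar> \<le> sqrt (2 * m * H\<^sub>0) * ?w" using w0 by (simp add: field_simps)
    also have "\<dots> \<le> sqrt (2 * m * H\<^sub>0) * (1 + \<epsilon>)"
      using w0(2) order_trans[OF abs_ge_zero \<open>\<bar>y / ?w\<bar> \<le> sqrt (2 * m * H\<^sub>0)\<close>]
      by (rule mult_left_mono)
    finally show ?thesis .
  qed
  moreover have "\<bar>p\<^sub>s t\<bar> \<le> \<bar>p\<^sub>s 0\<bar> + R * T"
  proof -
    have "R * t \<le> R * T" using t \<open>R \<ge> 0\<close> by (auto intro: mult_left_mono)
    then show ?thesis using motion by linarith
  qed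
  moreover have "e * M * ?I = y - p\<^sub>s t - e * integral {n t..N} (\<lambda>u. f u (s t))"
    unfolding y_def A_eq[OF nt(1)] by (simp add: algebra_simps)
  moreover have "\<bar>e * integral {n t..N} (\<lambda>u. f u (s t))\<bar> \<le> e * C\<^sub>f"
  proof -
    \<comment> \<open>N \<le> 1 makes the contribution of f at most \<open>C\<^sub>f\<close>, which
      becomes the first summand of \<open>D\<^sub>0\<close>.\<close>
    have "C\<^sub>f * (N - n t) \<le> C\<^sub>f * 1"
      using nt assms(12) \<open>C\<^sub>f \<ge> 0\<close> by (intro mult_left_mono) auto
    then show ?thesis using f_small[of "n t" "s t"] nt assms(2) by (simp add: abs_mult)
  qed
  ultimately have "\<bar>e * M * ?I\<bar> \<le> sqrt (2 * m * H\<^sub>0) * (1 + \<epsilon>) + (\<bar>p\<^sub>s 0\<bar> + R * T) + e * C\<^sub>f"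
    by linarith
  also have "\<dots> = e * \<bar>M\<bar> * d T"
  proof -
    \<comment> \<open>Stated for positive variables X and E, so that \<open>\<bar>M\<bar>\<close>
      and \<open>1 - \<epsilon>\<close> act as atoms when denominators are cleared.\<close>
    have "e * X * (C\<^sub>f / X + Z / (e * X) + (S * (D\<^sub>C / (X * E)) + h / (e * X * E)) * T)
        = e * C\<^sub>f + Z + (h / E + e * (S / E * D\<^sub>C)) * T" if "X > 0" "E > 0" for X E S h Z
      using that assms(2) by (simp add: field_simps)
    from this[of "\<bar>M\<bar>" "1 - \<epsilon>"] assms(14,18) show ?thesis
      unfolding assms(30,31,32) R_def by simp
  qed
  finally have "e * \<bar>M\<bar> * ?I \<le> e * \<bar>M\<bar> * d T"
    using assms(2) abs_ge_self[of ?I] mult_left_mono[of ?I "\<bar>?I\<bar>" "e * \<bar>M\<bar>"] by (simp add: abs_mult)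
  then have "?I \<le> d T" using assms(2,18) by simp
  then show "n t \<ge> (if \<alpha> > 1
                   then (N powr (- (\<alpha> - 1)) + (\<alpha> - 1) * d T) powr (- 1 / (\<alpha> - 1))
                   else N * exp (- d T))"
    by (rule integral_powr_lower_bound[OF nt assms(17)])
qed

end
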